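(* Let $r$ be a positive integer and let $\mathbb{M}=(V,\mathcal{C})$ be the rank-$r$ uniform matroid on $n\ge r+1$ elements, i.e. $|V|=n$ and $\mathcal{C}=\{C\subseteq V:|C|=r+1\}$. Let $|\mathbb{M}|_K$ be the minimum number of circuit clauses whose conjunction equals $\Phi_{\mathcal{C}}$. Then $|\mathbb{M}|_K=\binom{n}{r}$.
   Context: Boolean functions on $V$ are viewed as functions of subsets; the clause $B\to v$ ($v\notin B$) has true sets the $T$ with $B\not\subseteq T$ or $B\cup\{v\}\subseteq T$; $\Phi_{\mathcal{C}}=\bigwedge_{C\in\mathcal{C}}\bigwedge_{v\in C}((C\setminus\{v\})\to v)$. A circuit clause is a clause $(C\setminus\{v\})\to v$ with $C\in\mathcal{C}$ and $v\in C$; equality is equality of Boolean functions. *)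

theory Defs
  imports Main
begin

text \<open>
  A Boolean function on a ground set \<open>V\<close> is a predicate on sets, of which only the values at
  subsets of \<open>V\<close> matter; the sets at which it holds are its true sets.
\<close>

type_synonym 'a boolfun = "'a set \<Rightarrow> bool"

definition boolfun_eq :: "'a set \<Rightarrow> 'a boolfun \<Rightarrow> 'a boolfun \<Rightarrow> bool" where
  "boolfun_eq V f g \<longleftrightarrow> (\<forall>T. T \<subseteq> V \<longrightarrow> f T = g T)"

text \<open>The pair \<open>(B, v)\<close> represents the clause \<open>B \<rightarrow> v\<close>, where \<open>v \<notin> B\<close>.\<close>

type_synonym 'a clause = "'a set \<times> 'a"

definition clause_fun :: "'a clause \<Rightarrow> 'a boolfun" where
  "clause_fun = (\<lambda>(B, v) T. \<not> B \<subseteq> T \<or> B \<union> {v} \<subseteq> T)"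

definition conj_fun :: "'a clause set \<Rightarrow> 'a boolfun" where
  "conj_fun K T \<longleftrightarrow> (\<forall>c\<in>K. clause_fun c T)"

definition Phi :: "'a set set \<Rightarrow> 'a boolfun" where
  "Phi \<C> T \<longleftrightarrow> (\<forall>C\<in>\<C>. \<forall>v\<in>C. clause_fun (C - {v}, v) T)"

definition circuit_clauses :: "'a set set \<Rightarrow> 'a clause set" where
  "circuit_clauses \<C> = {(C - {v}, v) | C v. C \<in> \<C> \<and> v \<in> C}"

definition represents :: "'a set \<Rightarrow> 'a set set \<Rightarrow> 'a clause set \<Rightarrow> bool" where
  "represents V \<C> K \<longleftrightarrow>
     finite K \<and> K \<subseteq> circuit_clauses \<C> \<and> boolfun_eq V (conj_fun K) (Phi \<C>)"

definition min_circuit_clauses :: "'a set \<Rightarrow> 'a set set \<Rightarrow> nat" where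
  "min_circuit_clauses V \<C> = (LEAST k. \<exists>K. represents V \<C> K \<and> card K = k)"

text \<open>Over a finite ground set the minimum is attained, so the \<open>LEAST\<close> above is meaningful.\<close>

lemma represents_circuit_clauses:
  assumes "finite V" and "\<C> \<subseteq> Pow V"
  shows "represents V \<C> (circuit_clauses \<C>)"
proof -
  have "circuit_clauses \<C> \<subseteq> Pow V \<times> V"
    using assms(2) by (auto simp: circuit_clauses_def)
  moreover have "finite (Pow V \<times> V)"
    using assms(1) by simp
  ultimately have "finite (circuit_clauses \<C>)"
    by (rule finite_subset)
  moreover have "conj_fun (circuit_clauses \<C>) = Phi \<C>"
    unfolding conj_fun_def Phi_def circuit_clauses_def by (intro ext) blast
  ultimately show ?thesis
    by (simp add: represents_def boolfun_eq_def)
qed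

lemma min_circuit_clauses_attained:
  assumes "finite V" and "\<C> \<subseteq> Pow V"
  shows "\<exists>K. represents V \<C> K \<and> card K = min_circuit_clauses V \<C>"
  unfolding min_circuit_clauses_def
  by (rule LeastI_ex) (use represents_circuit_clauses[OF assms] in blast)

lemma min_circuit_clauses_le:
  "represents V \<C> K \<Longrightarrow> min_circuit_clauses V \<C> \<le> card K"
  unfolding min_circuit_clauses_def by (rule Least_le) blast

end

theory Submission
  imports Defs
begin

text \<open>
  For an \<open>r\<close>-set \<open>B\<close> the function \<open>\<Phi>\<close> is false at \<open>B\<close>, and the only circuit clauses false at
  \<open>B\<close> have body \<open>B\<close>; so every \<open>r\<close>-set is the body of some clause, and at least
  \<open>n choose r\<close> clauses are needed. Conversely it suffices to choose one head \<open>f B \<notin> B\<close> for each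
  \<open>r\<close>-set \<open>B\<close> so that no set \<open>T \<noteq> V\<close> with \<open>r\<close> or more elements is closed under all \<open>B \<rightarrow> f B\<close>.
  For \<open>r = 1\<close> a cyclic permutation of \<open>V\<close> does this. For larger \<open>r\<close> fix \<open>x \<in> V\<close>, put
  \<open>f B = x\<close> if \<open>x \<notin> B\<close>, so that a closed set contains \<open>x\<close>, and otherwise let
  \<open>f B\<close> be the head chosen for \<open>B - {x}\<close> in \<open>V - {x}\<close> at rank \<open>r - 1\<close>.
\<close>

text \<open>Supplies the heads for rank 1. On a finite set, having no proper nonempty closed subset
  forces \<open>f\<close> to run through \<open>V\<close> in a single cycle. Phrasing this through
  closed sets avoids orbits and is all that the induction needs.\<close>

lemma ex_transitive_function:
  assumes "finite V"
  shows "\<exists>f. f ` V \<subseteq> V \<and> (\<forall>T. T \<subseteq> V \<longrightarrow> T \<noteq> {} \<longrightarrow> f ` T \<subseteq> T \<longrightarrow> T = V)"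
  using assms
proof (induction V rule: finite_induct)
  case empty
  show ?case by simp
next
  case (insert x V)
  show ?case
  proof (cases "V = {}")
    case True
    show ?thesis
      by (rule exI[of _ id]) (use True in auto)
  next
    case False
    then obtain a where a: "a \<in> V" by blast
    from insert.IH obtain f where f: "f ` V \<subseteq> V"
      and trans: "\<And>T. \<lbrakk>T \<subseteq> V; T \<noteq> {}; f ` T \<subseteq> T\<rbrakk> \<Longrightarrow> T = V"
      by blast
    text \<open>Splice \<open>x\<close> into the cycle between \<open>a\<close> and \<open>f a\<close>.\<close>
    define g where "g = f(a := x, x := f a)"
    have "g ` insert x V \<subseteq> insert x V"
      using f a by (auto simp: g_def)
    moreover have "T = insert x V"
      if T: "T \<subseteq> insert x V" "T \<noteq> {}" "g ` T \<subseteq> T" for T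
    proof -
      have g: "g v \<in> T" if "v \<in> T" for v
        using T(3) that by blast
      have fa: "f a \<in> T" if "x \<in> T"
        using g[OF that] by (simp add: g_def)
      \<comment> \<open>On \<open>V\<close> the maps \<open>f\<close> and \<open>g\<close> differ
        only at \<open>a\<close>, and there two steps of \<open>g\<close> lead through
        \<open>x\<close> to \<open>f a\<close>.\<close>
      have "f v \<in> T" if "v \<in> T" "v \<in> V" for v
        using g[OF that(1)] fa that insert.hyps(2)
        by (auto simp: g_def split: if_splits)
      then have "f ` (T \<inter> V) \<subseteq> T \<inter> V"
        using f by blast
      moreover have "T \<inter> V \<noteq> {}"
        using T(1,2) fa f a by blast
      ultimately have "V \<subseteq> T"
        using trans[of "T \<inter> V"] by blast
      moreover have "x \<in> T"
      proof -
        have "a \<in> T"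
          using a \<open>V \<subseteq> T\<close> by blast
        moreover have "a \<noteq> x"
          using a insert.hyps(2) by blast
        ultimately show ?thesis
          using g[of a] by (simp add: g_def)
      qed
      ultimately show ?thesis
        using T(1) by blast
    qed
    ultimately show ?thesis by blast
  qed
qed

text \<open>The second property leaves as true sets of the chosen clauses only \<open>V\<close> and
  the sets with fewer than \<open>r\<close> elements, which are the true sets of \<open>Phi\<close>.
  The induction on \<open>r\<close> removes a point of \<open>V\<close>, so \<open>V\<close> has to
  vary.\<close>

lemma ex_spanning_heads:
  assumes "finite V" and "1 \<le> r" and "r < card V"
  shows "\<exists>f. (\<forall>B. B \<subseteq> V \<longrightarrow> card B = r \<longrightarrow> f B \<in> V - B) \<and>
    (\<forall>T. T \<subseteq> V \<longrightarrow> r \<le> card T \<longrightarrow> (\<forall>B. B \<subseteq> T \<longrightarrow> card B = r \<longrightarrow> f B \<in> T) \<longrightarrow> T = V)"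
  using assms(2,1,3)
proof (induction r arbitrary: V rule: nat_induct_at_least)
  case base
  obtain g where g: "g ` V \<subseteq> V"
    and trans: "\<And>T. \<lbrakk>T \<subseteq> V; T \<noteq> {}; g ` T \<subseteq> T\<rbrakk> \<Longrightarrow> T = V"
    using ex_transitive_function[OF base(1)] by blast
  \<comment> \<open>A fixed point would give a closed singleton, but \<open>V\<close> has more than
    one element.\<close>
  have "g v \<noteq> v" if "v \<in> V" for v
    using trans[of "{v}"] that base(2) by auto
  then have "\<forall>B. B \<subseteq> V \<longrightarrow> card B = 1 \<longrightarrow> g (the_elem B) \<in> V - B"
    using g by (auto simp: card_1_singleton_iff)
  moreover have "T = V"
    if "T \<subseteq> V" "1 \<le> card T" "\<forall>B. B \<subseteq> T \<longrightarrow> card B = 1 \<longrightarrow> g (the_elem B) \<in> T" for T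
  proof (rule trans)
    show "g ` T \<subseteq> T"
    proof
      fix y assume "y \<in> g ` T"
      then obtain v where "v \<in> T" "y = g v" by blast
      then show "y \<in> T"
        using that(3)[rule_format, of "{v}"] by simp
    qed
  qed (use that in auto)
  ultimately show ?case
    by (intro exI[of _ "\<lambda>B. g (the_elem B)"]) blast
next
  case (Suc r)
  then obtain x where x: "x \<in> V" by fastforce
  have "r < card (V - {x})"
    using Suc.prems x by simp
  with Suc.IH[of "V - {x}"] Suc.prems(1) obtain g
    where g: "\<And>B. \<lbrakk>B \<subseteq> V - {x}; card B = r\<rbrakk> \<Longrightarrow> g B \<in> V - {x} - B"
    and span: "\<And>T. \<lbrakk>T \<subseteq> V - {x}; r \<le> card T; \<And>B. \<lbrakk>B \<subseteq> T; card B = r\<rbrakk> \<Longrightarrow> g B \<in> T\<rbrakk>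
      \<Longrightarrow> T = V - {x}"
    by (metis finite_Diff)
  define f where "f B = (if x \<in> B then g (B - {x}) else x)" for B
  have "f B \<in> V - B" if "B \<subseteq> V" "card B = Suc r" for B
    using g[of "B - {x}", OF Diff_mono[OF that(1) subset_refl]] that x by (auto simp: f_def)
  moreover have "T = V"
    if T: "T \<subseteq> V" "Suc r \<le> card T" "\<forall>B. B \<subseteq> T \<longrightarrow> card B = Suc r \<longrightarrow> f B \<in> T" for T
  proof -
    have fin: "finite T"
      using T(1) Suc.prems(1) by (rule finite_subset)
    obtain B where B: "B \<subseteq> T" "card B = Suc r"
      using obtain_subset_with_card_n[OF T(2)] by metis
    \<comment> \<open>Either \<open>B\<close> already contains \<open>x\<close>, or
      \<open>f B\<close> is \<open>x\<close> itself.\<close>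
    then have "f B \<in> T"
      using T(3) by blast
    with B(1) have xT: "x \<in> T"
      by (auto simp: f_def split: if_splits)
    \<comment> \<open>Closure under \<open>f\<close> passes to closure under \<open>g\<close>:
      adding \<open>x\<close> to an \<open>r\<close>-set \<open>C\<close> gives a body inside
      \<open>T\<close> whose head is \<open>g C\<close>.\<close>
    have "T - {x} = V - {x}"
    proof (rule span)
      show "r \<le> card (T - {x})"
        using T(2) xT by simp
    next
      fix C assume C: "C \<subseteq> T - {x}" "card C = r"
      have "finite C"
        using C(1) fin by (meson finite_Diff finite_subset)
      with C have "card (insert x C) = Suc r"
        by (subst card_insert_disjoint) auto
      with C(1) xT have "f (insert x C) \<in> T"
        using T(3) by blast
      moreover have "f (insert x C) = g C"
        using C(1) by (simp add: f_def subset_Diff_insert)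
      moreover have "g C \<noteq> x"
        using g[of C] C T(1) by blast
      ultimately show "g C \<in> T - {x}" by simp
    qed (use T(1) in blast)
    with x xT T(1) show ?thesis by blast
  qed
  ultimately show ?case
    by (intro exI[of _ f]) blast
qed

lemma mem_circuit_clauses_uniform_iff:
  assumes "finite V"
  shows "(B, v) \<in> circuit_clauses {C. C \<subseteq> V \<and> card C = r + 1}
    \<longleftrightarrow> B \<subseteq> V \<and> card B = r \<and> v \<in> V - B"
proof
  assume "(B, v) \<in> circuit_clauses {C. C \<subseteq> V \<and> card C = r + 1}"
  then show "B \<subseteq> V \<and> card B = r \<and> v \<in> V - B"
    by (auto simp: circuit_clauses_def)
next
  assume B: "B \<subseteq> V \<and> card B = r \<and> v \<in> V - B"
  then have "card (insert v B) = r + 1"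
    using finite_subset[OF _ assms] by simp
  moreover have "insert v B - {v} = B"
    using B by simp
  ultimately show "(B, v) \<in> circuit_clauses {C. C \<subseteq> V \<and> card C = r + 1}"
    unfolding circuit_clauses_def using B by blast
qed

lemma Phi_iff_circuit_clauses: "Phi \<C> T \<longleftrightarrow> (\<forall>c\<in>circuit_clauses \<C>. clause_fun c T)"
  unfolding Phi_def circuit_clauses_def by blast

theorem theorem23:
  fixes V :: "'a set" and \<C> :: "'a set set" and r n :: nat
  assumes "r \<ge> 1" and "n \<ge> r + 1"
    and "finite V" and "card V = n"
    and "\<C> = {C. C \<subseteq> V \<and> card C = r + 1}"
  shows "min_circuit_clauses V \<C> = n choose r"
proof (rule antisym)
  note mem = mem_circuit_clauses_uniform_iff[OF assms(3), of _ _ r, folded assms(5)]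
  let ?R = "{B. B \<subseteq> V \<and> card B = r}"
  have cardR: "card ?R = n choose r"
    using n_subsets[OF assms(3)] assms(4) by simp
  have finR: "finite ?R"
    using assms(3) by simp
  show "min_circuit_clauses V \<C> \<le> n choose r"
  proof -
    obtain f where f: "\<And>B. \<lbrakk>B \<subseteq> V; card B = r\<rbrakk> \<Longrightarrow> f B \<in> V - B"
      and span: "\<And>T. \<lbrakk>T \<subseteq> V; r \<le> card T; \<And>B. \<lbrakk>B \<subseteq> T; card B = r\<rbrakk> \<Longrightarrow> f B \<in> T\<rbrakk> \<Longrightarrow> T = V"
      using ex_spanning_heads[OF assms(3,1)] assms(2,4) by (metis Suc_eq_plus1 Suc_le_eq)
    define K where "K = (\<lambda>B. (B, f B)) ` ?R"
    have K: "K \<subseteq> circuit_clauses \<C>"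
      using f by (auto simp: K_def mem)
    have "conj_fun K T = Phi \<C> T" if T: "T \<subseteq> V" for T
    proof
      assume "Phi \<C> T"
      with K show "conj_fun K T"
        by (auto simp: conj_fun_def Phi_iff_circuit_clauses)
    next
      assume conj: "conj_fun K T"
      show "Phi \<C> T"
      \<comment> \<open>A large \<open>T\<close> must be \<open>V\<close>, which contains every
        head; a small \<open>T\<close> contains no body, so all circuit clauses hold
        vacuously.\<close>
      proof (cases "r \<le> card T")
        case True
        have "f B \<in> T" if "B \<subseteq> T" "card B = r" for B
          using conj that T by (auto simp: conj_fun_def K_def clause_fun_def)
        with T True have "T = V" by (rule span)
        then show ?thesis
          by (auto simp: Phi_iff_circuit_clauses mem clause_fun_def)
      next
        case False
        then have "\<not> B \<subseteq> T" if "card B = r" for B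
          using that card_mono finite_subset[OF T assms(3)] by metis
        then show ?thesis
          by (auto simp: Phi_iff_circuit_clauses mem clause_fun_def)
      qed
    qed
    with K finR have "represents V \<C> K"
      by (simp add: represents_def boolfun_eq_def K_def)
    then have "min_circuit_clauses V \<C> \<le> card K"
      by (rule min_circuit_clauses_le)
    also have "card K \<le> n choose r"
      unfolding K_def cardR[symmetric] by (rule card_image_le[OF finR])
    finally show ?thesis .
  qed
  show "n choose r \<le> min_circuit_clauses V \<C>"
  proof -
    have "\<C> \<subseteq> Pow V"
      using assms(5) by blast
    then obtain K where K: "represents V \<C> K" "card K = min_circuit_clauses V \<C>"
      using min_circuit_clauses_attained[OF assms(3)] by blast
    have "B \<in> fst ` K" if B: "B \<subseteq> V" "card B = r" for B
    proof -
      \<comment> \<open>As \<open>r < n\<close>, some \<open>v\<close> lies outside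
        \<open>B\<close>, and the circuit clause with body \<open>B\<close> and head
        \<open>v\<close> fails at \<open>B\<close>.\<close>
      have "B \<noteq> V"
        using B(2) assms(2,4) by auto
      with B(1) obtain v where v: "v \<in> V - B" by blast
      with B have "\<not> Phi \<C> B"
        by (auto simp: Phi_iff_circuit_clauses mem clause_fun_def)
      with K(1) B(1) have "\<not> conj_fun K B"
        by (simp add: represents_def boolfun_eq_def)
      then obtain B' w where c: "(B', w) \<in> K" "B' \<subseteq> B"
        by (auto simp: conj_fun_def clause_fun_def)
      with K(1) have "card B' = r"
        using mem by (auto simp: represents_def)
      with c(2) B have "B' = B"
        using card_subset_eq[of B B'] finite_subset[OF B(1) assms(3)] by simp
      with c(1) show ?thesis by force
    qed
    \<comment> \<open>Bodies are counted instead of clauses, since several clauses of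
      \<open>K\<close> may share a body.\<close>
    then have "?R \<subseteq> fst ` K" by blast
    moreover have "finite K"
      using K(1) by (simp add: represents_def)
    ultimately have "card ?R \<le> card K"
      by (rule surj_card_le[rotated])
    with cardR K(2) show ?thesis by simp
  qed
qed

end
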